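(* Let $Y:=\lambda\bigl((\lambda\,(v_1\cdot(v_0\cdot v_0)))\cdot(\lambda\,(v_1\cdot(v_0\cdot v_0)))\bigr)$ and let $L:=Y\cdot(\lambda\,\neg v_0)$ be the Liar term. Then the judgment $\{L\}\vdash L$ is derivable in RGA, but $\emptyset\vdash\neg L\lor L$ is not derivable in RGA.
   Context: **Terms.** Raw terms are: variables $v_i$ ($i\in\mathbb N$, de Bruijn indices), and operator nodes, each consisting of an operator code, a binder count $k\in\mathbb N$ and a finite list of raw terms as arguments, in each of which the $k$ lowest indices are bound. RGA has ten operators: constants $\bot$, $\mathbf 0$, $\mathcal R$ (recursor), $\mathcal A$ (universal quantifier combinator); unary $\mathbf S$, $\neg$; unary $\lambda$ (binder count 1, the only binder); binary $=$, $\lor$, and application $\cdot$ (left associative). A term $t$ is well-formed, $\mathrm{wf}(t)$, iff it is built from variables and these ten operators at these arities and binder counts. "Term" means raw term; formulas are just terms. Closed means having no free variables. $\underline n=\mathbf S^n\mathbf 0$ is the numeral of $n$. $[v_i\mapsto s]t$ (also $[i\mapsto s]t$): capture-avoiding replacement of the free variable $v_i$ by $s$, other free variables unchanged. $b[t]$: $\beta$-instance, replacing index $0$ in $b$ by $t$ and decrementing all other free indices. $\uparrow t$: all free indices increased by one; $\uparrow\Gamma$ elementwise. $\mathrm{fv}$: set of free variables. Abbreviations: $t\neq u:=\neg(t=u)$; $t\,\mathsf N:=(t=t)$; $t\,\mathsf B:=(t\lor\neg t)$; $t\land u:=\neg(\neg t\lor\neg u)$. **Head steps** $t\triangleright t'$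 (syntactic relation): $(\lambda b)\cdot t\triangleright b[t]$ if $\mathrm{wf}(t)$; $\mathcal R\cdot g\cdot h\cdot\mathbf 0\triangleright g$ if $\mathrm{wf}(h)$; $\mathcal R\cdot g\cdot h\cdot(\mathbf S\,\underline n)\triangleright h\cdot\underline n\cdot(\mathcal R\cdot g\cdot h\cdot\underline n)$ if $\mathrm{wf}(g)$; and $t\cdot u\triangleright t'\cdot u$ if $t\triangleright t'$. **Proofs.** A judgment $\Gamma\vdash c$ has a finite set $\Gamma$ of terms and a term $c$. A proof is a finite list of judgments each following from earlier entries by one rule below; a judgment is derivable if some proof contains it. Writing $\Gamma\vdash c$ as an assertion means derivability. Rules ($\Rightarrow$ from premises to conclusion, $\Leftrightarrow$ both directions): Structural: $\mathrm{wf}(c)\Rightarrow\Gamma,c\vdash c$; $\Gamma\vdash c\Rightarrow\Gamma,a\vdash c$; $\Gamma\vdash a$ and $\Gamma,a\vdash c\Rightarrow\Gamma\vdash c$; $\Gamma\vdash c$ with $\Gamma,c,s$ well-formed $\Rightarrow[v\mapsto s]\Gamma\vdash[v\mapsto s]c$. Truth values: $\Gamma\vdash a\Leftrightarrow\Gamma\vdash a=\underline 1$; $\Gamma\vdash\neg a\Leftrightarrow\Gamma\vdash a=\underline 0$. Negation: $\Gamma\vdash\neg a$, $\Gamma\vdash a$, $\mathrm{wf}(c)\Rightarrow\Gamma\vdash c$; $\Gamma\vdash a\Leftrightarrow\Gamma\vdash\neg\neg a$. Disjunction: $\Gamma\vdash a$, $\mathrm{wf}(b)\Rightarrow\Gamma\vdash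 a\lor b$; $\Gamma\vdash b$, $\mathrm{wf}(a)\Rightarrow\Gamma\vdash a\lor b$; $\Gamma\vdash\neg a$, $\Gamma\vdash\neg b\Rightarrow\Gamma\vdash\neg(a\lor b)$; $\Gamma\vdash a\lor b$, $\Gamma,a\vdash c$, $\Gamma,b\vdash c\Rightarrow\Gamma\vdash c$; $\Gamma\vdash\neg(a\lor b)\Rightarrow\Gamma\vdash\neg a$, and $\Rightarrow\Gamma\vdash\neg b$. Equality: $\Gamma\vdash a\,\mathsf N\Leftrightarrow\Gamma\vdash a=a$; $\Gamma\vdash a=b\Rightarrow\Gamma\vdash b=a$; $\Gamma\vdash a=b$, $\Gamma\vdash[v\mapsto a]p$, $\mathrm{wf}(p)\Rightarrow\Gamma\vdash[v\mapsto b]p$; $\Gamma\vdash a\ne b\Rightarrow\Gamma\vdash b\ne a$; $\Gamma\vdash a\,\mathsf N$, $\Gamma\vdash b\,\mathsf N\Rightarrow\Gamma\vdash(a=b)\,\mathsf B$; $\Gamma\vdash(a=b)\,\mathsf B\Rightarrow\Gamma\vdash(a\,\mathsf N)\land(b\,\mathsf N)$. Naturals: $\Gamma\vdash\mathbf 0\,\mathsf N$; $\Gamma\vdash a\,\mathsf N\Leftrightarrow\Gamma\vdash\mathbf S a\,\mathsf N$; $\Gamma\vdash a\,\mathsf N\Rightarrow\Gamma\vdash\mathbf S a\ne\mathbf 0$; $\Gamma\vdash a\ne b\Leftrightarrow\Gamma\vdash\mathbf S a\ne\mathbf S b$; $\Gamma\vdash\mathbf S a=\mathbf S b\Rightarrow\Gamma\vdash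 a=b$; $\Gamma\vdash\bot\,\mathsf N$, $\mathrm{wf}(p)\Rightarrow\Gamma\vdash p$. Induction: $\Gamma\vdash[i\mapsto\mathbf 0]c$; $v_i\,\mathsf N,c,\Gamma\vdash[i\mapsto\mathbf S v_i]c$; $\Gamma\vdash a\,\mathsf N$; $\mathrm{wf}(c)$; $i\notin\mathrm{fv}(\Gamma)$ $\Rightarrow\Gamma\vdash[i\mapsto a]c$. Conversion: if $c\triangleright c'$: $\Gamma\vdash c'\Leftrightarrow\Gamma\vdash c$; $\Gamma\vdash c'\,\mathsf N\Rightarrow\Gamma\vdash c=c'$. Recursor: $\Gamma\vdash m\,\mathsf N$, $\Gamma\vdash(h\cdot m\cdot(\mathcal R\cdot g\cdot h\cdot m))\,\mathsf N$, $\mathrm{wf}(g)\Rightarrow\Gamma\vdash\mathcal R\cdot g\cdot h\cdot(\mathbf S m)=h\cdot m\cdot(\mathcal R\cdot g\cdot h\cdot m)$. Quantifier: $v_0\,\mathsf N,\uparrow\Gamma\vdash\uparrow f\cdot v_0\Rightarrow\Gamma\vdash\mathcal A\cdot f$; $\Gamma\vdash\mathcal A\cdot f$, $\Gamma\vdash a\,\mathsf N\Rightarrow\Gamma\vdash f\cdot a$; $\Gamma\vdash\neg(f\cdot a)$, $\Gamma\vdash a\,\mathsf N\Rightarrow\Gamma\vdash\neg(\mathcal A\cdot f)$; $\Gamma\vdash\neg(\mathcal A\cdot f)$ and $v_0\,\mathsf N,\neg(\uparrow f\cdot v_0),\uparrow\Gamma\vdash\uparrow c\Rightarrow\Gamma\vdash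 c$. *)

theory Defs
  imports "HOL-Library.FSet"
begin

(* Op c k ts: operator code c, binder count k; the k lowest indices are bound in every
   element of ts. Raw terms need not respect the signature of RGA; see wf_tm. *)
datatype rterm = Var nat | Op nat nat "rterm list"

(* The operator codes 0, ..., 9 are an arbitrary injective numbering of the operators. *)

abbreviation Bot :: rterm where "Bot \<equiv> Op 0 0 []"
abbreviation Zero :: rterm where "Zero \<equiv> Op 1 0 []"
abbreviation Rec :: rterm where "Rec \<equiv> Op 2 0 []"
abbreviation AllC :: rterm where "AllC \<equiv> Op 3 0 []"
abbreviation Succ :: "rterm \<Rightarrow> rterm" where "Succ t \<equiv> Op 4 0 [t]"
abbreviation Neg :: "rterm \<Rightarrow> rterm" (\<open>\<^bold>\<not> _\<close> [70] 70) where "\<^bold>\<not> t \<equiv> Op 5 0 [t]"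
abbreviation Lam :: "rterm \<Rightarrow> rterm" where "Lam b \<equiv> Op 6 1 [b]"
abbreviation Eq :: "rterm \<Rightarrow> rterm \<Rightarrow> rterm" (infix \<open>\<^bold>=\<close> 65) where "t \<^bold>= u \<equiv> Op 7 0 [t, u]"
abbreviation Disj :: "rterm \<Rightarrow> rterm \<Rightarrow> rterm" (infixr \<open>\<^bold>\<or>\<close> 60) where "t \<^bold>\<or> u \<equiv> Op 8 0 [t, u]"
abbreviation App :: "rterm \<Rightarrow> rterm \<Rightarrow> rterm" (infixl \<open>\<cdot>\<close> 75) where "t \<cdot> u \<equiv> Op 9 0 [t, u]"

abbreviation Neq :: "rterm \<Rightarrow> rterm \<Rightarrow> rterm" (infix \<open>\<^bold>\<noteq>\<close> 65)
  where "t \<^bold>\<noteq> u \<equiv> \<^bold>\<not> (t \<^bold>= u)"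
abbreviation Conj :: "rterm \<Rightarrow> rterm \<Rightarrow> rterm" (infixr \<open>\<^bold>\<and>\<close> 62)
  where "t \<^bold>\<and> u \<equiv> \<^bold>\<not> (\<^bold>\<not> t \<^bold>\<or> \<^bold>\<not> u)"
abbreviation isN :: "rterm \<Rightarrow> rterm" where "isN t \<equiv> t \<^bold>= t"
abbreviation isB :: "rterm \<Rightarrow> rterm" where "isB t \<equiv> t \<^bold>\<or> \<^bold>\<not> t"

primrec num :: "nat \<Rightarrow> rterm" where
  "num 0 = Zero"
| "num (Suc n) = Succ (num n)"

(* triples (operator code, binder count, arity) *)
definition signature :: "(nat \<times> nat \<times> nat) set" where
  "signature =
    {(0, 0, 0), (1, 0, 0), (2, 0, 0), (3, 0, 0), (4, 0, 1), (5, 0, 1), (6, 1, 1),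
     (7, 0, 2), (8, 0, 2), (9, 0, 2)}"

fun wf_tm :: "rterm \<Rightarrow> bool" where
  "wf_tm (Var i) \<longleftrightarrow> True"
| "wf_tm (Op c k ts) \<longleftrightarrow> (c, k, length ts) \<in> signature \<and> (\<forall>t\<in>set ts. wf_tm t)"

fun fv :: "rterm \<Rightarrow> nat set" where
  "fv (Var i) = {i}"
| "fv (Op c k ts) = {i. \<exists>t\<in>set ts. i + k \<in> fv t}"

fun shift :: "nat \<Rightarrow> nat \<Rightarrow> rterm \<Rightarrow> rterm" where
  "shift d n (Var i) = (if i < n then Var i else Var (i + d))"
| "shift d n (Op c k ts) = Op c k (map (shift d (n + k)) ts)"

abbreviation lift :: "rterm \<Rightarrow> rterm" (\<open>\<up> _\<close> [80] 80) where "\<up> t \<equiv> shift 1 0 t"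

fun subst :: "nat \<Rightarrow> rterm \<Rightarrow> rterm \<Rightarrow> rterm" (\<open>[_ \<^bold>\<mapsto> _] _\<close> [0, 0, 80] 80) where
  "[i \<^bold>\<mapsto> s] (Var j) = (if j = i then s else Var j)"
| "[i \<^bold>\<mapsto> s] (Op c k ts) = Op c k (map (\<lambda>t. [i + k \<^bold>\<mapsto> shift k 0 s] t) ts)"

fun inst :: "nat \<Rightarrow> rterm \<Rightarrow> rterm \<Rightarrow> rterm" where
  "inst n s (Var j) = (if j < n then Var j else if j = n then s else Var (j - 1))"
| "inst n s (Op c k ts) = Op c k (map (inst (n + k) (shift k 0 s)) ts)"

abbreviation beta :: "rterm \<Rightarrow> rterm \<Rightarrow> rterm" where "beta b t \<equiv> inst 0 t b"

inductive head_step :: "rterm \<Rightarrow> rterm \<Rightarrow> bool" (infix \<open>\<triangleright>\<close> 50) where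
  hs_beta: "wf_tm t \<Longrightarrow> Lam b \<cdot> t \<triangleright> beta b t"
| hs_rec_zero: "wf_tm h \<Longrightarrow> Rec \<cdot> g \<cdot> h \<cdot> Zero \<triangleright> g"
| hs_rec_succ: "wf_tm g \<Longrightarrow> Rec \<cdot> g \<cdot> h \<cdot> Succ (num n) \<triangleright> h \<cdot> num n \<cdot> (Rec \<cdot> g \<cdot> h \<cdot> num n)"
| hs_app: "t \<triangleright> t' \<Longrightarrow> t \<cdot> u \<triangleright> t' \<cdot> u"

datatype rga_judgment = Judgment "rterm fset" rterm (infix \<open>\<turnstile>\<close> 55)

(* rga_rule P j: the conclusion j follows from the premises P by a single rule;
   rules stated as equivalences are split into two clauses *)
inductive rga_rule :: "rga_judgment set \<Rightarrow> rga_judgment \<Rightarrow> bool" where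
  hyp: "wf_tm c \<Longrightarrow> rga_rule {} (finsert c \<Gamma> \<turnstile> c)"
| weaken: "rga_rule {\<Gamma> \<turnstile> c} (finsert a \<Gamma> \<turnstile> c)"
| cut: "rga_rule {\<Gamma> \<turnstile> a, finsert a \<Gamma> \<turnstile> c} (\<Gamma> \<turnstile> c)"
| subst_rule: "(\<And>g. g |\<in>| \<Gamma> \<Longrightarrow> wf_tm g) \<Longrightarrow> wf_tm c \<Longrightarrow> wf_tm s \<Longrightarrow>
    rga_rule {\<Gamma> \<turnstile> c} (subst v s |`| \<Gamma> \<turnstile> [v \<^bold>\<mapsto> s] c)"
| true_eqI: "rga_rule {\<Gamma> \<turnstile> a} (\<Gamma> \<turnstile> a \<^bold>= num 1)"
| true_eqE: "rga_rule {\<Gamma> \<turnstile> a \<^bold>= num 1} (\<Gamma> \<turnstile> a)"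
| false_eqI: "rga_rule {\<Gamma> \<turnstile> \<^bold>\<not> a} (\<Gamma> \<turnstile> a \<^bold>= num 0)"
| false_eqE: "rga_rule {\<Gamma> \<turnstile> a \<^bold>= num 0} (\<Gamma> \<turnstile> \<^bold>\<not> a)"
| negE: "wf_tm c \<Longrightarrow> rga_rule {\<Gamma> \<turnstile> \<^bold>\<not> a, \<Gamma> \<turnstile> a} (\<Gamma> \<turnstile> c)"
| neg_negI: "rga_rule {\<Gamma> \<turnstile> a} (\<Gamma> \<turnstile> \<^bold>\<not> \<^bold>\<not> a)"
| neg_negE: "rga_rule {\<Gamma> \<turnstile> \<^bold>\<not> \<^bold>\<not> a} (\<Gamma> \<turnstile> a)"
| disjI1: "wf_tm b \<Longrightarrow> rga_rule {\<Gamma> \<turnstile> a} (\<Gamma> \<turnstile> a \<^bold>\<or> b)"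
| disjI2: "wf_tm a \<Longrightarrow> rga_rule {\<Gamma> \<turnstile> b} (\<Gamma> \<turnstile> a \<^bold>\<or> b)"
| neg_disjI: "rga_rule {\<Gamma> \<turnstile> \<^bold>\<not> a, \<Gamma> \<turnstile> \<^bold>\<not> b} (\<Gamma> \<turnstile> \<^bold>\<not> (a \<^bold>\<or> b))"
| disjE: "rga_rule {\<Gamma> \<turnstile> a \<^bold>\<or> b, finsert a \<Gamma> \<turnstile> c, finsert b \<Gamma> \<turnstile> c} (\<Gamma> \<turnstile> c)"
| neg_disjE1: "rga_rule {\<Gamma> \<turnstile> \<^bold>\<not> (a \<^bold>\<or> b)} (\<Gamma> \<turnstile> \<^bold>\<not> a)"
| neg_disjE2: "rga_rule {\<Gamma> \<turnstile> \<^bold>\<not> (a \<^bold>\<or> b)} (\<Gamma> \<turnstile> \<^bold>\<not> b)"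
| isN_eq: "rga_rule {\<Gamma> \<turnstile> isN a} (\<Gamma> \<turnstile> a \<^bold>= a)"
| eq_isN: "rga_rule {\<Gamma> \<turnstile> a \<^bold>= a} (\<Gamma> \<turnstile> isN a)"
| eq_sym: "rga_rule {\<Gamma> \<turnstile> a \<^bold>= b} (\<Gamma> \<turnstile> b \<^bold>= a)"
| eq_subst: "wf_tm p \<Longrightarrow> rga_rule {\<Gamma> \<turnstile> a \<^bold>= b, \<Gamma> \<turnstile> [v \<^bold>\<mapsto> a] p} (\<Gamma> \<turnstile> [v \<^bold>\<mapsto> b] p)"
| neq_sym: "rga_rule {\<Gamma> \<turnstile> a \<^bold>\<noteq> b} (\<Gamma> \<turnstile> b \<^bold>\<noteq> a)"
| eq_isB: "rga_rule {\<Gamma> \<turnstile> isN a, \<Gamma> \<turnstile> isN b} (\<Gamma> \<turnstile> isB (a \<^bold>= b))"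
| isB_eqE: "rga_rule {\<Gamma> \<turnstile> isB (a \<^bold>= b)} (\<Gamma> \<turnstile> isN a \<^bold>\<and> isN b)"
| zero_isN: "rga_rule {} (\<Gamma> \<turnstile> isN Zero)"
| succ_isNI: "rga_rule {\<Gamma> \<turnstile> isN a} (\<Gamma> \<turnstile> isN (Succ a))"
| succ_isNE: "rga_rule {\<Gamma> \<turnstile> isN (Succ a)} (\<Gamma> \<turnstile> isN a)"
| succ_neq_zero: "rga_rule {\<Gamma> \<turnstile> isN a} (\<Gamma> \<turnstile> Succ a \<^bold>\<noteq> Zero)"
| succ_neqI: "rga_rule {\<Gamma> \<turnstile> a \<^bold>\<noteq> b} (\<Gamma> \<turnstile> Succ a \<^bold>\<noteq> Succ b)"
| succ_neqE: "rga_rule {\<Gamma> \<turnstile> Succ a \<^bold>\<noteq> Succ b} (\<Gamma> \<turnstile> a \<^bold>\<noteq> b)"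
| succ_eqE: "rga_rule {\<Gamma> \<turnstile> Succ a \<^bold>= Succ b} (\<Gamma> \<turnstile> a \<^bold>= b)"
| bot_isNE: "wf_tm p \<Longrightarrow> rga_rule {\<Gamma> \<turnstile> isN Bot} (\<Gamma> \<turnstile> p)"
| nat_induction: "wf_tm c \<Longrightarrow> (\<And>g. g |\<in>| \<Gamma> \<Longrightarrow> i \<notin> fv g) \<Longrightarrow>
    rga_rule
      {\<Gamma> \<turnstile> [i \<^bold>\<mapsto> Zero] c,
       finsert (isN (Var i)) (finsert c \<Gamma>) \<turnstile> [i \<^bold>\<mapsto> Succ (Var i)] c,
       \<Gamma> \<turnstile> isN a}
      (\<Gamma> \<turnstile> [i \<^bold>\<mapsto> a] c)"
| conv_expand: "c \<triangleright> c' \<Longrightarrow> rga_rule {\<Gamma> \<turnstile> c'} (\<Gamma> \<turnstile> c)"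
| conv_reduce: "c \<triangleright> c' \<Longrightarrow> rga_rule {\<Gamma> \<turnstile> c} (\<Gamma> \<turnstile> c')"
| conv_eq: "c \<triangleright> c' \<Longrightarrow> rga_rule {\<Gamma> \<turnstile> isN c'} (\<Gamma> \<turnstile> c \<^bold>= c')"
| rec_succ: "wf_tm g \<Longrightarrow>
    rga_rule {\<Gamma> \<turnstile> isN m, \<Gamma> \<turnstile> isN (h \<cdot> m \<cdot> (Rec \<cdot> g \<cdot> h \<cdot> m))}
      (\<Gamma> \<turnstile> Rec \<cdot> g \<cdot> h \<cdot> Succ m \<^bold>= h \<cdot> m \<cdot> (Rec \<cdot> g \<cdot> h \<cdot> m))"
| allI: "rga_rule {finsert (isN (Var 0)) (lift |`| \<Gamma>) \<turnstile> \<up> f \<cdot> Var 0} (\<Gamma> \<turnstile> AllC \<cdot> f)"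
| allE: "rga_rule {\<Gamma> \<turnstile> AllC \<cdot> f, \<Gamma> \<turnstile> isN a} (\<Gamma> \<turnstile> f \<cdot> a)"
| neg_allI: "rga_rule {\<Gamma> \<turnstile> \<^bold>\<not> (f \<cdot> a), \<Gamma> \<turnstile> isN a} (\<Gamma> \<turnstile> \<^bold>\<not> (AllC \<cdot> f))"
| neg_allE: "rga_rule
      {\<Gamma> \<turnstile> \<^bold>\<not> (AllC \<cdot> f),
       finsert (isN (Var 0)) (finsert (\<^bold>\<not> (\<up> f \<cdot> Var 0)) (lift |`| \<Gamma>)) \<turnstile> \<up> c}
      (\<Gamma> \<turnstile> c)"

definition is_proof :: "rga_judgment list \<Rightarrow> bool" where
  "is_proof js \<longleftrightarrow> (\<forall>n<length js. \<exists>P\<subseteq>set (take n js). rga_rule P (js ! n))"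

definition derivable :: "rga_judgment \<Rightarrow> bool" where
  "derivable j \<longleftrightarrow> (\<exists>js. is_proof js \<and> j \<in> set js)"

definition Y_comb :: rterm where
  "Y_comb = Lam (Lam (Var 1 \<cdot> (Var 0 \<cdot> Var 0)) \<cdot> Lam (Var 1 \<cdot> (Var 0 \<cdot> Var 0)))"

definition Liar :: rterm where
  "Liar = Y_comb \<cdot> Lam (\<^bold>\<not> Var 0)"

end

theory Submission
  imports Defs
begin

text \<open>
  The judgment \<open>{L} \<turnstile> L\<close> is an instance of the hypothesis rule, since the Liar term is well-formed.
  Underivability of \<open>\<turnstile> \<not> L \<or> L\<close> follows from a model in which the Liar has no truth value.

  The model is a least-fixed-point, Kripke-style semantics: a term may evaluate to at most one
  natural number, truth is evaluation to 1, falsity evaluation to 0, and a disjunction is true only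
  if one of its disjuncts is. Evaluation is call-by-name, presented as a machine with a stack of
  pending arguments, and a universally quantified formula is true when all its numeral instances
  are (an infinitary clause). Working with the stack makes every clause directed by the shape of
  the head term, so evaluation is functional (\<open>runs_functional\<close>).

  A judgment is valid if every substitution that makes the hypotheses true makes the conclusion
  true. Terms are substituted and evaluated even when open, which is harmless: a free variable in
  head position has no value, so evaluation is stable under substitution (\<open>runs_psub\<close>).
  Most rules are sound by reading off the clauses of evaluation. The exception is replacement of
  equals: terms with the same value must be exchangeable wherever they are substituted, also below
  binders and in argument position, where they have not been evaluated yet. This is
  \<open>same_value_congruent\<close>, proved by showing that the least relation that identifies
  terms with equal values and is compatible with all operators preserves the runs of the machine
  (\<open>sim_runs\<close>). The rules for induction, the recursor and the quantifier rest on the same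
  relation, to pass between a term with a value and the numeral of that value.

  By soundness, derivability of \<open>\<not> L \<or> L\<close> from no hypotheses would give \<open>L\<close> a value. But \<open>L\<close>
  head-reduces to a term \<open>D \<cdot> D\<close> that head-reduces to \<open>\<not> (D \<cdot> D)\<close>, so a value would
  equal its own negation.
\<close>

section \<open>Parallel substitution\<close>

lemma shift_0: "shift 0 n t = t"
  by (induction "0::nat" n t rule: shift.induct) (auto intro: map_idI)

definition up :: "nat \<Rightarrow> (nat \<Rightarrow> rterm) \<Rightarrow> nat \<Rightarrow> rterm" where
  "up k \<sigma> i = (if i < k then Var i else shift k 0 (\<sigma> (i - k)))"

lemma up_0 [simp]: "up 0 \<sigma> = \<sigma>"
  by (simp add: up_def fun_eq_iff shift_0)

text \<open>
  Shifting, single substitution and instantiation are all special cases of this operation; hence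
  every commutation law between them is a consequence of the composition law \<open>psub_psub\<close>.
\<close>

fun psub :: "(nat \<Rightarrow> rterm) \<Rightarrow> rterm \<Rightarrow> rterm" where
  "psub \<sigma> (Var i) = \<sigma> i"
| "psub \<sigma> (Op c k ts) = Op c k (map (psub (up k \<sigma>)) ts)"

lemma shift_eq_psub: "shift d n t = psub (\<lambda>i. Var (if i < n then i else i + d)) t"
proof (induction d n t rule: shift.induct)
  case (2 d n c k ts)
  have "up k (\<lambda>i. Var (if i < n then i else i + d)) = (\<lambda>i. Var (if i < n + k then i else i + d))"
    by (auto simp: up_def fun_eq_iff)
  with 2 show ?case by simp
qed auto

lemma subst_eq_psub: "[i \<^bold>\<mapsto> s] t = psub (\<lambda>j. if j = i then s else Var j) t"
proof (induction i s t rule: subst.induct)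
  case (2 i s c k ts)
  have "up k (\<lambda>j. if j = i then s else Var j) = (\<lambda>j. if j = i + k then shift k 0 s else Var j)"
    by (auto simp: up_def fun_eq_iff)
  with 2 show ?case by simp
qed auto

lemma inst_eq_psub:
  "inst n s t = psub (\<lambda>j. if j < n then Var j else if j = n then s else Var (j - 1)) t"
proof (induction n s t rule: inst.induct)
  case (2 n s c k ts)
  have "up k (\<lambda>j. if j < n then Var j else if j = n then s else Var (j - 1)) =
      (\<lambda>j. if j < n + k then Var j else if j = n + k then shift k 0 s else Var (j - 1))"
    by (auto simp: up_def fun_eq_iff)
  with 2 show ?case by simp
qed auto

text \<open>
  The composition law is needed below binders for its own proof: pushing a lifted substitution
  through a shift is an instance of composition with a renaming. So composition is established
  first with a renaming on the inside, then with one on the outside, and then in general.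
\<close>

lemma psub_rename: "psub \<sigma> (psub (\<lambda>i. Var (\<rho> i)) t) = psub (\<lambda>i. \<sigma> (\<rho> i)) t"
proof (induction t arbitrary: \<sigma> \<rho>)
  case (Op c k ts)
  let ?\<rho> = "\<lambda>i. if i < k then i else \<rho> (i - k) + k"
  have "up k (\<lambda>i. Var (\<rho> i)) = (\<lambda>i. Var (?\<rho> i))"
    and "up k (\<lambda>i. \<sigma> (\<rho> i)) = (\<lambda>i. up k \<sigma> (?\<rho> i))"
    by (auto simp: up_def fun_eq_iff)
  with Op show ?case by simp
qed simp

lemma rename_psub:
  "psub (\<lambda>i. Var (\<rho> i)) (psub \<sigma> t) = psub (\<lambda>i. psub (\<lambda>i. Var (\<rho> i)) (\<sigma> i)) t"
proof (induction t arbitrary: \<sigma> \<rho>)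
  case (Op c k ts)
  let ?\<rho> = "\<lambda>i. if i < k then i else \<rho> (i - k) + k"
  have "up k (\<lambda>i. Var (\<rho> i)) = (\<lambda>i. Var (?\<rho> i))"
    by (auto simp: up_def fun_eq_iff)
  moreover have "up k (\<lambda>i. psub (\<lambda>i. Var (\<rho> i)) (\<sigma> i)) = (\<lambda>i. psub (\<lambda>i. Var (?\<rho> i)) (up k \<sigma> i))"
    by (auto simp: up_def fun_eq_iff shift_eq_psub psub_rename)
  ultimately show ?case using Op by simp
qed simp

lemma psub_psub: "psub \<sigma> (psub \<tau> t) = psub (\<lambda>i. psub \<sigma> (\<tau> i)) t"
proof (induction t arbitrary: \<sigma> \<tau>)
  case (Op c k ts)
  have "psub (up k \<sigma>) (shift k 0 u) = shift k 0 (psub \<sigma> u)" for u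
    unfolding shift_eq_psub psub_rename rename_psub by (simp add: up_def shift_eq_psub)
  then have "up k (\<lambda>i. psub \<sigma> (\<tau> i)) = (\<lambda>i. psub (up k \<sigma>) (up k \<tau> i))"
    by (auto simp: up_def fun_eq_iff)
  with Op show ?case by simp
qed simp

lemma psub_Var: "psub Var t = t"
proof (induction t)
  case (Op c k ts)
  have "up k Var = Var" by (auto simp: up_def fun_eq_iff)
  with Op show ?case by (simp add: map_idI)
qed simp

lemma psub_cong_fv: "(\<And>i. i \<in> fv t \<Longrightarrow> \<sigma> i = \<tau> i) \<Longrightarrow> psub \<sigma> t = psub \<tau> t"
proof (induction t arbitrary: \<sigma> \<tau>)
  case (Op c k ts)
  have "psub (up k \<sigma>) t = psub (up k \<tau>) t" if t: "t \<in> set ts" for t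
  proof (rule Op.IH[OF t])
    fix i assume "i \<in> fv t"
    with t have "k \<le> i \<Longrightarrow> i - k \<in> fv (Op c k ts)" by auto
    then show "up k \<sigma> i = up k \<tau> i" using Op.prems by (auto simp: up_def)
  qed
  then show ?case by simp
qed simp

lemma psub_num [simp]: "psub \<sigma> (num n) = num n"
  by (induction n arbitrary: \<sigma>) auto

lemma psub_subst: "psub \<sigma> ([v \<^bold>\<mapsto> s] t) = psub (\<sigma>(v := psub \<sigma> s)) t"
proof -
  have "(\<lambda>i. psub \<sigma> (if i = v then s else Var i)) = \<sigma>(v := psub \<sigma> s)" by auto
  then show ?thesis by (simp add: subst_eq_psub psub_psub)
qed

lemma psub_lift: "psub (case_nat s \<sigma>) (\<up> t) = psub \<sigma> t"
  by (simp add: shift_eq_psub psub_rename)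

lemma psub_beta: "psub \<sigma> (beta b a) = beta (psub (up 1 \<sigma>) b) (psub \<sigma> a)"
proof -
  have cancel: "psub (\<lambda>j. if j = 0 then s else Var (j - 1)) (shift 1 0 t) = t" for s t
    by (simp add: shift_eq_psub psub_rename psub_Var)
  have "(\<lambda>i. psub \<sigma> (if i = 0 then a else Var (i - 1)))
      = (\<lambda>i. psub (\<lambda>j. if j = 0 then psub \<sigma> a else Var (j - 1)) (up 1 \<sigma> i))"
    using cancel by (auto simp: up_def fun_eq_iff)
  then show ?thesis by (simp add: inst_eq_psub psub_psub)
qed

section \<open>Evaluation\<close>

text \<open>
  The term in head position is run against the arguments that it is applied to, the innermost
  argument first. The recursor is more liberal than head reduction: its last argument may be any
  term with a value, as replacement of equals demands. Ill-formed operator nodes, the constant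
  \<open>Bot\<close> and variables are stuck.
\<close>

inductive runs :: "rterm \<Rightarrow> rterm list \<Rightarrow> nat \<Rightarrow> bool" where
  Zero: "runs Zero [] 0"
| Succ: "runs a [] n \<Longrightarrow> runs (Succ a) [] (Suc n)"
| Neg_true: "runs a [] 1 \<Longrightarrow> runs (\<^bold>\<not> a) [] 0"
| Neg_false: "runs a [] 0 \<Longrightarrow> runs (\<^bold>\<not> a) [] 1"
| Eq: "runs a [] m \<Longrightarrow> runs b [] n \<Longrightarrow> runs (a \<^bold>= b) [] (if m = n then 1 else 0)"
| Disj_true1: "runs a [] 1 \<Longrightarrow> runs (a \<^bold>\<or> b) [] 1"
| Disj_true2: "runs b [] 1 \<Longrightarrow> runs (a \<^bold>\<or> b) [] 1"
| Disj_false: "runs a [] 0 \<Longrightarrow> runs b [] 0 \<Longrightarrow> runs (a \<^bold>\<or> b) [] 0"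
| All_true: "(\<And>n. runs f [num n] 1) \<Longrightarrow> runs AllC [f] 1"
| All_false: "runs f [num n] 0 \<Longrightarrow> runs AllC [f] 0"
| App: "runs t (u # st) n \<Longrightarrow> runs (t \<cdot> u) st n"
| Lam: "runs (beta b a) st n \<Longrightarrow> runs (Lam b) (a # st) n"
| Rec_zero: "runs k [] 0 \<Longrightarrow> runs g st n \<Longrightarrow> runs Rec (g # h # k # st) n"
| Rec_succ: "runs k [] (Suc j) \<Longrightarrow> runs h (num j # (Rec \<cdot> g \<cdot> h \<cdot> num j) # st) n \<Longrightarrow>
    runs Rec (g # h # k # st) n"

\<comment> \<open>The clauses of evaluation speak of 1, so the simplifier must not turn it into \<open>Suc 0\<close>.\<close>
declare One_nat_def [simp del]

inductive_simps runs_Bot [simp]: "runs Bot st n"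
inductive_simps runs_Zero [simp]: "runs Zero st n"
inductive_simps runs_Succ: "runs (Succ a) st n"
inductive_simps runs_Neg: "runs (\<^bold>\<not> a) st n"
inductive_simps runs_Eq: "runs (a \<^bold>= b) st n"
inductive_simps runs_Disj: "runs (a \<^bold>\<or> b) st n"
inductive_simps runs_All: "runs AllC st n"
inductive_simps runs_App [simp]: "runs (t \<cdot> u) st n"
inductive_simps runs_Lam: "runs (Lam b) st n"
inductive_simps runs_Rec: "runs Rec st n"

text \<open>
  Functionality is proved together with the fact that a term with a value is no function:
  it gets stuck on any further arguments. That second part is what makes terms with equal values
  exchangeable in head position, where both are stuck.
\<close>

lemma runs_functional: "runs t st n \<Longrightarrow> runs t (st @ cs) m \<Longrightarrow> cs = [] \<and> m = n"
proof (induction t st n arbitrary: cs m rule: runs.induct)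
  case Zero
  then show ?case by simp
next
  case (Succ a n)
  then obtain i where "cs = []" "m = Suc i" "runs a [] i" by (auto simp: runs_Succ)
  with Succ.IH[of "[]" i] show ?case by simp
next
  case (Neg_true a)
  then show ?case using Neg_true.IH[of "[]" 0] by (auto simp: runs_Neg)
next
  case (Neg_false a)
  then show ?case using Neg_false.IH[of "[]" 1] by (auto simp: runs_Neg)
next
  case (Eq a i b j)
  then obtain i' j' where "cs = []" "runs a [] i'" "runs b [] j'" "m = (if i' = j' then 1 else 0)"
    by (auto simp only: runs_Eq append_is_Nil_conv)
  with Eq.IH(1)[of "[]" i'] Eq.IH(2)[of "[]" j'] show ?case by simp
next
  case (Disj_true1 a b)
  then show ?case using Disj_true1.IH[of "[]" 0] by (auto simp: runs_Disj)
next
  case (Disj_true2 b a)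
  then show ?case using Disj_true2.IH[of "[]" 0] by (auto simp: runs_Disj)
next
  case (Disj_false a b)
  then show ?case
    using Disj_false.IH(1)[of "[]" 1] Disj_false.IH(2)[of "[]" 1] by (auto simp: runs_Disj)
next
  case (All_true f)
  then show ?case using All_true.IH[of _ "[]" 0] by (auto simp: runs_All)
next
  case (All_false f n)
  then show ?case using All_false.IH[of "[]" 1] by (auto simp: runs_All)
next
  case (App t u st n)
  then show ?case by simp
next
  case (Lam b a st n)
  then show ?case by (simp add: runs_Lam)
next
  case (Rec_zero k g st n h)
  have "\<not> runs k [] (Suc i)" for i using Rec_zero.IH(1)[of "[]" "Suc i"] by auto
  with Rec_zero.prems have "runs g (st @ cs) m" by (simp add: runs_Rec)
  then show ?case by (rule Rec_zero.IH(2))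
next
  case (Rec_succ k j h g st n)
  have "i = Suc j" if "runs k [] i" for i using Rec_succ.IH(1)[of "[]" i] that by simp
  with Rec_succ.prems have "runs h ((num j # (Rec \<cdot> g \<cdot> h \<cdot> num j) # st) @ cs) m"
    by (fastforce simp: runs_Rec)
  then show ?case by (rule Rec_succ.IH(2))
qed

lemma value_unique: "runs t [] n \<Longrightarrow> runs t [] m \<Longrightarrow> m = n"
  using runs_functional[of t "[]" n "[]" m] by simp

lemma value_num [simp]: "runs (num n) [] m \<longleftrightarrow> m = n"
  by (induction n arbitrary: m) (auto simp: runs_Succ)

text \<open>
  The evaluation of a term never inspects a free variable, so it can be replayed after
  substituting for the free variables.
\<close>

lemma runs_psub: "runs t st n \<Longrightarrow> runs (psub \<sigma> t) (map (psub \<sigma>) st) n"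
proof (induction t st n rule: runs.induct)
  case (Lam b a st n)
  then show ?case by (auto simp: psub_beta intro: runs.Lam)
next
  case (Eq a i b j)
  then show ?case by (auto simp: runs_Eq)
next
  case (Rec_succ k j h g st n)
  then show ?case by (auto intro: runs.Rec_succ)
qed (auto intro: runs.intros)

section \<open>Terms with equal values are exchangeable\<close>

text \<open>
  Transitivity is left out: a single exchange of terms with a common value never needs it, and
  without it related terms either share a value or have the same operator at the root. Stability of
  evaluation under substitution makes the relation closed under substitution.
\<close>

inductive sim :: "rterm \<Rightarrow> rterm \<Rightarrow> bool" where
  sim_value: "runs a [] n \<Longrightarrow> runs b [] n \<Longrightarrow> sim a b"
| sim_Var: "sim (Var i) (Var i)"
| sim_Op: "list_all2 sim ts us \<Longrightarrow> sim (Op c k ts) (Op c k us)"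

lemma sim_refl: "sim t t"
proof (induction t)
  case (Op c k ts)
  then show ?case by (simp add: sim_Op list.rel_refl_strong)
qed (rule sim_Var)

lemma sim_psub: "sim t u \<Longrightarrow> (\<And>i. sim (\<sigma> i) (\<tau> i)) \<Longrightarrow> sim (psub \<sigma> t) (psub \<tau> u)"
proof (induction t u arbitrary: \<sigma> \<tau> rule: sim.induct)
  case (sim_value a n b)
  then show ?case using runs_psub[of _ "[]" n] by (auto intro: sim.sim_value)
next
  case (sim_Op ts us c k)
  \<comment> \<open>Lifting a substitution below a binder shifts its terms, so renamings are needed first.\<close>
  have rename: "sim (psub (\<lambda>i. Var (\<rho> i)) t) (psub (\<lambda>i. Var (\<rho> i)) u)" if "sim t u" for \<rho> t u
    using that
  proof (induction t u arbitrary: \<rho> rule: sim.induct)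
    case (sim_value a n b)
    then show ?case using runs_psub[of _ "[]" n] by (auto intro: sim.sim_value)
  next
    case (sim_Op ts us c k)
    have "up k (\<lambda>i. Var (\<rho> i)) = (\<lambda>i. Var (if i < k then i else \<rho> (i - k) + k))"
      by (auto simp: up_def fun_eq_iff)
    moreover have "list_all2 (\<lambda>t u. sim (psub (\<lambda>i. Var (\<rho>' i)) t) (psub (\<lambda>i. Var (\<rho>' i)) u)) ts us" for \<rho>'
      using sim_Op.IH by (rule list_all2_mono) blast
    ultimately show ?case by (simp add: list_all2_map1 list_all2_map2 sim.sim_Op)
  qed (simp add: sim_Var)
  have "sim (up k \<sigma> i) (up k \<tau> i)" for i
    using sim_Op.prems by (simp add: up_def sim_Var shift_eq_psub rename)
  then have "list_all2 (\<lambda>t u. sim (psub (up k \<sigma>) t) (psub (up k \<tau>) u)) ts us"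
    using sim_Op.IH by (auto elim: list_all2_mono)
  then show ?case by (simp add: list_all2_map1 list_all2_map2 sim.sim_Op)
qed simp

text \<open>
  Related head terms with a common value can only run against the empty stack, by
  \<open>runs_functional\<close>, and there they agree. This leaves the case of heads with the same operator.
\<close>

lemma sim_run_Op:
  assumes "sim (Op c k ts) u" and run: "runs (Op c k ts) st n" and st: "list_all2 sim st st'"
    and structural: "\<And>us. list_all2 sim ts us \<Longrightarrow> runs (Op c k us) st' n"
  shows "runs u st' n"
  using assms(1)
proof (cases rule: sim.cases)
  case (sim_value m)
  with run have "st = []" "n = m" using runs_functional[of _ "[]" m st n] by auto
  with st sim_value show ?thesis by simp
qed (use structural in auto)

text \<open>
  With the common-value case out of the way, the related term always starts with the same clause of
  evaluation. The step for an abstraction is where closure of the relation under substitution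
  enters, since the related arguments get copied into the related bodies.
\<close>

lemma sim_runs: "runs t st n \<Longrightarrow> sim t u \<Longrightarrow> list_all2 sim st st' \<Longrightarrow> runs u st' n"
proof (induction t st n arbitrary: u st' rule: runs.induct)
  case Zero
  show ?case
    by (rule sim_run_Op[OF Zero(1) runs.Zero Zero(2)]) (use Zero in auto)
next
  case (Succ a n)
  show ?case
    by (rule sim_run_Op[OF Succ.prems(1) runs.Succ[OF Succ.hyps] Succ.prems(2)])
      (use Succ.prems in \<open>auto simp: list_all2_Cons1 intro: runs.Succ Succ.IH\<close>)
next
  case (Neg_true a)
  show ?case
    by (rule sim_run_Op[OF Neg_true.prems(1) runs.Neg_true[OF Neg_true.hyps] Neg_true.prems(2)])
      (use Neg_true.prems in \<open>auto simp: list_all2_Cons1 intro: runs.Neg_true Neg_true.IH\<close>)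
next
  case (Neg_false a)
  show ?case
    by (rule sim_run_Op[OF Neg_false.prems(1) runs.Neg_false[OF Neg_false.hyps] Neg_false.prems(2)])
      (use Neg_false.prems in \<open>auto simp: list_all2_Cons1 intro: runs.Neg_false Neg_false.IH\<close>)
next
  case (Eq a i b j)
  show ?case
    by (rule sim_run_Op[OF Eq.prems(1) runs.Eq[OF Eq.hyps] Eq.prems(2)])
      (use Eq.prems in \<open>auto split del: if_split simp: list_all2_Cons1 intro!: runs.Eq Eq.IH\<close>)
next
  case (Disj_true1 a b)
  show ?case
    by (rule sim_run_Op[OF Disj_true1.prems(1) runs.Disj_true1[OF Disj_true1.hyps] Disj_true1.prems(2)])
      (use Disj_true1.prems in \<open>auto simp: list_all2_Cons1 runs_Disj Disj_true1.IH\<close>)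
next
  case (Disj_true2 b a)
  show ?case
    by (rule sim_run_Op[OF Disj_true2.prems(1) runs.Disj_true2[OF Disj_true2.hyps] Disj_true2.prems(2)])
      (use Disj_true2.prems in \<open>auto simp: list_all2_Cons1 runs_Disj Disj_true2.IH\<close>)
next
  case (Disj_false a b)
  show ?case
    by (rule sim_run_Op[OF Disj_false.prems(1) runs.Disj_false[OF Disj_false.hyps] Disj_false.prems(2)])
      (use Disj_false.prems in \<open>auto simp: list_all2_Cons1 runs_Disj Disj_false.IH\<close>)
next
  case (All_true f)
  show ?case
    by (rule sim_run_Op[OF All_true.prems(1) runs.All_true[OF All_true.hyps] All_true.prems(2)])
      (use All_true.prems in
        \<open>auto simp: list_all2_Cons1 intro!: runs.All_true All_true.IH intro: sim_refl\<close>)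
next
  case (All_false f n)
  show ?case
    by (rule sim_run_Op[OF All_false.prems(1) runs.All_false[OF All_false.hyps] All_false.prems(2)])
      (use All_false.prems in
        \<open>auto simp: list_all2_Cons1 intro!: runs.All_false[of _ n] All_false.IH intro: sim_refl\<close>)
next
  case (App t u' st n)
  show ?case
    by (rule sim_run_Op[OF App.prems(1) runs.App[OF App.hyps] App.prems(2)])
      (use App.prems in \<open>auto simp del: runs_App simp: list_all2_Cons1 intro!: runs.App App.IH\<close>)
next
  case (Lam b a st n)
  show ?case
  proof (rule sim_run_Op[OF Lam.prems(1) runs.Lam[OF Lam.hyps] Lam.prems(2)])
    fix us assume "list_all2 sim [b] us"
    then obtain b' where b': "us = [b']" "sim b b'" by (auto simp: list_all2_Cons1)
    from Lam.prems obtain a' st2 where a': "st' = a' # st2" "sim a a'" "list_all2 sim st st2"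
      by (auto simp: list_all2_Cons1)
    have "sim (beta b a) (beta b' a')"
      unfolding inst_eq_psub using a' b' by (intro sim_psub) (auto intro: sim_refl)
    with Lam.IH a' b' show "runs (Op 6 1 us) st' n" by (auto intro: runs.Lam)
  qed
next
  case (Rec_zero k g st n h)
  show ?case
    by (rule sim_run_Op[OF Rec_zero.prems(1) runs.Rec_zero[OF Rec_zero.hyps] Rec_zero.prems(2)])
      (use Rec_zero.prems in \<open>auto simp: list_all2_Cons1 Rec_zero.IH intro!: runs.Rec_zero\<close>)
next
  case (Rec_succ k j h g st n)
  show ?case
  proof (rule sim_run_Op[OF Rec_succ.prems(1) runs.Rec_succ[OF Rec_succ.hyps] Rec_succ.prems(2)])
    fix us assume "list_all2 sim [] us"
    then have us: "us = []" by simp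
    from Rec_succ.prems obtain g' h' k' st2 where st':
      "st' = g' # h' # k' # st2" "sim g g'" "sim h h'" "sim k k'" "list_all2 sim st st2"
      by (auto simp: list_all2_Cons1)
    have "sim (Rec \<cdot> g \<cdot> h \<cdot> num j) (Rec \<cdot> g' \<cdot> h' \<cdot> num j)"
      using st' by (auto intro!: sim_Op intro: sim_refl)
    with st' have "runs h' (num j # (Rec \<cdot> g' \<cdot> h' \<cdot> num j) # st2) n"
      by (auto intro!: Rec_succ.IH(2) intro: sim_refl)
    with st' us Rec_succ.IH(1) show "runs (Op 2 0 us) st' n" by (auto intro: runs.Rec_succ)
  qed
qed

lemma same_value_congruent:
  assumes "runs a [] k" "runs b [] k" "runs (psub (\<sigma>(v := a)) p) [] n"
  shows "runs (psub (\<sigma>(v := b)) p) [] n"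
proof -
  have "sim (psub (\<sigma>(v := a)) p) (psub (\<sigma>(v := b)) p)"
    by (rule sim_psub) (use assms in \<open>auto intro: sim_refl sim_value\<close>)
  with assms show ?thesis using sim_runs by blast
qed

lemma same_value_App:
  assumes "runs a [] k" "runs b [] k" "runs (f \<cdot> a) [] n"
  shows "runs (f \<cdot> b) [] n"
proof -
  have "sim (f \<cdot> a) (f \<cdot> b)" using assms by (auto intro!: sim_Op intro: sim_refl sim_value)
  with assms(3) show ?thesis using sim_runs by blast
qed

section \<open>Soundness\<close>

text \<open>
  Quantifying over the stack is what carries a head step through the application rule, which only
  moves one more argument onto the stack.
\<close>

lemma head_step_runs: "t \<triangleright> t' \<Longrightarrow> runs (psub \<sigma> t) st n \<longleftrightarrow> runs (psub \<sigma> t') st n"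
proof (induction arbitrary: st rule: head_step.induct)
  case (hs_beta t b)
  then show ?case by (simp add: psub_beta runs_Lam)
next
  case (hs_rec_zero h g)
  then show ?case by (simp add: runs_Rec)
next
  case (hs_rec_succ g h n)
  then show ?case by (simp add: runs_Rec runs_Succ)
qed simp

definition holds :: "(nat \<Rightarrow> rterm) \<Rightarrow> rterm \<Rightarrow> bool" where
  "holds \<sigma> t \<longleftrightarrow> runs (psub \<sigma> t) [] 1"

fun valid :: "rga_judgment \<Rightarrow> bool" where
  "valid (\<Gamma> \<turnstile> c) \<longleftrightarrow> (\<forall>\<sigma>. (\<forall>g\<in>fset \<Gamma>. holds \<sigma> g) \<longrightarrow> holds \<sigma> c)"

lemma validI:
  "(\<And>\<sigma>. \<forall>g\<in>fset \<Gamma>. holds \<sigma> g \<Longrightarrow> holds \<sigma> c) \<Longrightarrow> valid (\<Gamma> \<turnstile> c)"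
  by simp

lemma validD: "valid (\<Gamma> \<turnstile> c) \<Longrightarrow> \<forall>g\<in>fset \<Gamma>. holds \<sigma> g \<Longrightarrow> holds \<sigma> c"
  by simp

lemma holds_Neg: "holds \<sigma> (\<^bold>\<not> a) \<longleftrightarrow> runs (psub \<sigma> a) [] 0"
  by (simp add: holds_def runs_Neg)

lemma holds_Eq: "holds \<sigma> (a \<^bold>= b) \<longleftrightarrow> (\<exists>n. runs (psub \<sigma> a) [] n \<and> runs (psub \<sigma> b) [] n)"
  by (auto simp: holds_def runs_Eq split: if_splits)

lemma holds_eq_one: "holds \<sigma> (a \<^bold>= num 1) \<longleftrightarrow> holds \<sigma> a"
  unfolding holds_Eq by (simp add: holds_def)

lemma holds_neg_neg: "holds \<sigma> (\<^bold>\<not> \<^bold>\<not> a) \<longleftrightarrow> holds \<sigma> a"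
  unfolding holds_Neg by (simp add: holds_def runs_Neg)

lemma holds_Disj: "holds \<sigma> (a \<^bold>\<or> b) \<longleftrightarrow> holds \<sigma> a \<or> holds \<sigma> b"
  by (auto simp: holds_def runs_Disj)

lemma holds_Conj: "holds \<sigma> (a \<^bold>\<and> b) \<longleftrightarrow> holds \<sigma> a \<and> holds \<sigma> b"
  unfolding holds_Neg by (auto simp: holds_def runs_Disj runs_Neg)

lemma holds_Neq:
  "holds \<sigma> (a \<^bold>\<noteq> b) \<longleftrightarrow> (\<exists>m n. runs (psub \<sigma> a) [] m \<and> runs (psub \<sigma> b) [] n \<and> m \<noteq> n)"
  unfolding holds_Neg by (auto simp: runs_Eq)

lemma holds_Succ_neq: "holds \<sigma> (Succ a \<^bold>\<noteq> Succ b) \<longleftrightarrow> holds \<sigma> (a \<^bold>\<noteq> b)"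
proof -
  have "holds \<sigma> (Succ a \<^bold>\<noteq> Succ b) \<longleftrightarrow>
      (\<exists>m n. runs (psub \<sigma> a) [] m \<and> runs (psub \<sigma> b) [] n \<and> Suc m \<noteq> Suc n)"
    unfolding holds_Neq by (auto simp only: psub.simps list.map up_0 runs_Succ)
  then show ?thesis by (simp add: holds_Neq)
qed

lemma holds_unique: "holds \<sigma> a \<Longrightarrow> \<not> runs (psub \<sigma> a) [] 0"
  unfolding holds_def using value_unique by fastforce

lemma holds_lift: "holds (case_nat s \<sigma>) (\<up> t) \<longleftrightarrow> holds \<sigma> t"
  by (simp add: holds_def psub_lift)

lemma valid_subst:
  assumes "valid (\<Gamma> \<turnstile> c)"
  shows "valid (subst v s |`| \<Gamma> \<turnstile> [v \<^bold>\<mapsto> s] c)"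
proof -
  have "holds \<sigma> ([v \<^bold>\<mapsto> s] t) \<longleftrightarrow> holds (\<sigma>(v := psub \<sigma> s)) t" for \<sigma> t
    by (simp add: holds_def psub_subst)
  with assms show ?thesis by (simp del: fun_upd_apply)
qed

text \<open>
  The rule is an ordinary induction over the numerals, to which the step premise is applied with
  the variable \<open>i\<close> reassigned; freshness of \<open>i\<close> keeps the hypotheses true. The numeral of
  the value of \<open>a\<close> is then exchanged for \<open>a\<close>.
\<close>

lemma valid_induction:
  assumes zero: "valid (\<Gamma> \<turnstile> [i \<^bold>\<mapsto> Zero] c)"
    and step: "valid (finsert (isN (Var i)) (finsert c \<Gamma>) \<turnstile> [i \<^bold>\<mapsto> Succ (Var i)] c)"
    and nat: "valid (\<Gamma> \<turnstile> isN a)"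
    and fresh: "\<And>g. g |\<in>| \<Gamma> \<Longrightarrow> i \<notin> fv g"
  shows "valid (\<Gamma> \<turnstile> [i \<^bold>\<mapsto> a] c)"
proof (rule validI)
  fix \<sigma> assume \<Gamma>: "\<forall>g\<in>fset \<Gamma>. holds \<sigma> g"
  have num: "holds (\<sigma>(i := num k)) c" for k
  proof (induction k)
    case 0
    from validD[OF zero \<Gamma>] show ?case by (simp add: holds_def psub_subst del: fun_upd_apply)
  next
    case (Suc k)
    have "holds (\<sigma>(i := num k)) g" if "g |\<in>| \<Gamma>" for g
    proof -
      have "psub (\<sigma>(i := num k)) g = psub \<sigma> g"
        using fresh[OF that] by (intro psub_cong_fv) auto
      with \<Gamma> that show ?thesis by (simp add: holds_def)
    qed
    moreover have "holds (\<sigma>(i := num k)) (isN (Var i))" by (auto simp: holds_Eq)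
    ultimately have "\<forall>g\<in>fset (finsert (isN (Var i)) (finsert c \<Gamma>)). holds (\<sigma>(i := num k)) g"
      using Suc by (simp del: fun_upd_apply)
    then have "holds (\<sigma>(i := num k)) ([i \<^bold>\<mapsto> Succ (Var i)] c)"
      by (rule validD[OF step])
    then show ?case by (simp add: holds_def psub_subst del: fun_upd_apply) simp
  qed
  from validD[OF nat \<Gamma>] obtain k where k: "runs (psub \<sigma> a) [] k" by (auto simp: holds_Eq)
  from num[of k] show "holds \<sigma> ([i \<^bold>\<mapsto> a] c)"
    unfolding holds_def psub_subst by (rule same_value_congruent[OF value_num[THEN iffD2, OF refl] k])
qed

lemma valid_eq_subst:
  assumes "valid (\<Gamma> \<turnstile> a \<^bold>= b)" "valid (\<Gamma> \<turnstile> [v \<^bold>\<mapsto> a] p)"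
  shows "valid (\<Gamma> \<turnstile> [v \<^bold>\<mapsto> b] p)"
proof (rule validI)
  fix \<sigma> assume \<Gamma>: "\<forall>g\<in>fset \<Gamma>. holds \<sigma> g"
  with assms obtain k where "runs (psub \<sigma> a) [] k" "runs (psub \<sigma> b) [] k"
    by (auto simp: holds_Eq)
  moreover from assms \<Gamma> have "holds \<sigma> ([v \<^bold>\<mapsto> a] p)" by simp
  ultimately show "holds \<sigma> ([v \<^bold>\<mapsto> b] p)"
    unfolding holds_def psub_subst by (rule same_value_congruent)
qed

text \<open>
  Evaluation feeds the numeral of the value of \<open>m\<close> to \<open>h\<close>, whereas the rule speaks of \<open>m\<close> itself;
  exchanging the two does not change the value.
\<close>

lemma valid_rec_succ:
  assumes "valid (\<Gamma> \<turnstile> isN m)" "valid (\<Gamma> \<turnstile> isN (h \<cdot> m \<cdot> (Rec \<cdot> g \<cdot> h \<cdot> m)))"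
  shows "valid (\<Gamma> \<turnstile> Rec \<cdot> g \<cdot> h \<cdot> Succ m \<^bold>= h \<cdot> m \<cdot> (Rec \<cdot> g \<cdot> h \<cdot> m))"
proof (rule validI)
  fix \<sigma> assume \<Gamma>: "\<forall>g\<in>fset \<Gamma>. holds \<sigma> g"
  define m' g' h' where "m' = psub \<sigma> m" and "g' = psub \<sigma> g" and "h' = psub \<sigma> h"
  from assms[THEN validD, OF \<Gamma>] obtain k n where k: "runs m' [] k" and n: "runs (h' \<cdot> m' \<cdot> (Rec \<cdot> g' \<cdot> h' \<cdot> m')) [] n"
    by (auto simp: holds_Eq m'_def g'_def h'_def)
  have "sim m' (num k)" using k by (auto intro: sim_value)
  then have "sim (h' \<cdot> m' \<cdot> (Rec \<cdot> g' \<cdot> h' \<cdot> m')) (h' \<cdot> num k \<cdot> (Rec \<cdot> g' \<cdot> h' \<cdot> num k))"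
    by (auto intro!: sim_Op intro: sim_refl)
  with n have "runs (h' \<cdot> num k \<cdot> (Rec \<cdot> g' \<cdot> h' \<cdot> num k)) [] n" using sim_runs by blast
  moreover have "runs (Succ m') [] (Suc k)" using k by (rule runs.Succ)
  ultimately have "runs (Rec \<cdot> g' \<cdot> h' \<cdot> Succ m') [] n" by (auto intro: runs.Rec_succ)
  with n show "holds \<sigma> (Rec \<cdot> g \<cdot> h \<cdot> Succ m \<^bold>= h \<cdot> m \<cdot> (Rec \<cdot> g \<cdot> h \<cdot> m))"
    by (auto simp: holds_Eq m'_def g'_def h'_def)
qed

lemma holds_All: "holds \<sigma> (AllC \<cdot> f) \<longleftrightarrow> (\<forall>n. runs (psub \<sigma> f \<cdot> num n) [] 1)"
  by (auto simp: holds_def runs_All)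

lemma holds_neg_All: "holds \<sigma> (\<^bold>\<not> (AllC \<cdot> f)) \<longleftrightarrow> (\<exists>n. runs (psub \<sigma> f \<cdot> num n) [] 0)"
  by (auto simp: holds_Neg runs_All)

text \<open>
  In the quantifier rules the new variable 0 is interpreted by a numeral and the lifted terms keep
  their meaning, by \<open>holds_lift\<close>.
\<close>

lemma valid_allI:
  assumes "valid (finsert (isN (Var 0)) (lift |`| \<Gamma>) \<turnstile> \<up> f \<cdot> Var 0)"
  shows "valid (\<Gamma> \<turnstile> AllC \<cdot> f)"
proof (rule validI)
  fix \<sigma> assume \<Gamma>: "\<forall>g\<in>fset \<Gamma>. holds \<sigma> g"
  have "holds (case_nat (num n) \<sigma>) (\<up> f \<cdot> Var 0)" for n
    using \<Gamma> by (intro validD[OF assms]) (simp add: holds_lift holds_Eq)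
  then show "holds \<sigma> (AllC \<cdot> f)"
    unfolding holds_All by (simp add: holds_def psub_lift)
qed

lemma valid_neg_allE:
  assumes "valid (\<Gamma> \<turnstile> \<^bold>\<not> (AllC \<cdot> f))"
    and "valid (finsert (isN (Var 0)) (finsert (\<^bold>\<not> (\<up> f \<cdot> Var 0)) (lift |`| \<Gamma>)) \<turnstile> \<up> c)"
  shows "valid (\<Gamma> \<turnstile> c)"
proof (rule validI)
  fix \<sigma> assume \<Gamma>: "\<forall>g\<in>fset \<Gamma>. holds \<sigma> g"
  with assms(1) obtain n where "runs (psub \<sigma> f \<cdot> num n) [] 0" by (auto simp: holds_neg_All)
  then have "holds (case_nat (num n) \<sigma>) (\<^bold>\<not> (\<up> f \<cdot> Var 0))" by (simp add: holds_Neg psub_lift)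
  with \<Gamma> have "holds (case_nat (num n) \<sigma>) (\<up> c)"
    by (intro validD[OF assms(2)]) (simp add: holds_lift holds_Eq)
  then show "holds \<sigma> c" by (simp add: holds_lift)
qed

lemma rga_rule_valid: "rga_rule P j \<Longrightarrow> \<forall>j\<in>P. valid j \<Longrightarrow> valid j"
proof (induction P j rule: rga_rule.induct)
  case (hyp c \<Gamma>)
  show ?case by simp
next
  case (weaken \<Gamma> c a)
  then show ?case by simp
next
  case (cut \<Gamma> a c)
  then show ?case by simp
next
  case (subst_rule \<Gamma> c s v)
  then show ?case using valid_subst by (simp del: valid.simps)
next
  case (true_eqI \<Gamma> a)
  then show ?case by (simp add: holds_eq_one)
next
  case (true_eqE \<Gamma> a)
  then show ?case by (simp add: holds_eq_one)
next
  case (false_eqI \<Gamma> a)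
  then show ?case by (auto simp: holds_Eq holds_Neg)
next
  case (false_eqE \<Gamma> a)
  then show ?case by (auto simp: holds_Eq holds_Neg)
next
  case (negE c \<Gamma> a)
  then show ?case using holds_unique by (auto simp: holds_Neg)
next
  case (neg_negI \<Gamma> a)
  then show ?case by (simp add: holds_neg_neg)
next
  case (neg_negE \<Gamma> a)
  then show ?case by (simp add: holds_neg_neg)
next
  case (disjI1 b \<Gamma> a)
  then show ?case by (simp add: holds_Disj)
next
  case (disjI2 a \<Gamma> b)
  then show ?case by (simp add: holds_Disj)
next
  case (disjE \<Gamma> a b c)
  then show ?case by (simp add: holds_Disj) blast
next
  case (neg_disjI \<Gamma> a b)
  then show ?case by (auto simp: holds_Neg runs_Disj)
next
  case (neg_disjE1 \<Gamma> a b)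
  then show ?case by (auto simp: holds_Neg runs_Disj)
next
  case (neg_disjE2 \<Gamma> a b)
  then show ?case by (auto simp: holds_Neg runs_Disj)
next
  case (isN_eq \<Gamma> a)
  then show ?case by simp
next
  case (eq_isN \<Gamma> a)
  then show ?case by simp
next
  case (eq_sym \<Gamma> a b)
  then show ?case by (auto simp: holds_Eq)
next
  case (eq_subst p \<Gamma> a b v)
  then show ?case using valid_eq_subst[of \<Gamma> a b v p] by (simp del: valid.simps)
next
  case (neq_sym \<Gamma> a b)
  then show ?case by (fastforce simp: holds_Neq)
next
  case (eq_isB \<Gamma> a b)
  then show ?case by (fastforce simp: holds_Disj holds_Eq holds_Neq)
next
  case (isB_eqE \<Gamma> a b)
  then show ?case by (fastforce simp: holds_Disj holds_Conj holds_Eq holds_Neq)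
next
  case (zero_isN \<Gamma>)
  then show ?case by (simp add: holds_Eq)
next
  case (succ_isNI \<Gamma> a)
  then show ?case by (auto simp: holds_Eq runs_Succ)
next
  case (succ_isNE \<Gamma> a)
  then show ?case by (auto simp: holds_Eq runs_Succ)
next
  case (succ_neq_zero \<Gamma> a)
  then show ?case by (fastforce simp: holds_Eq holds_Neq runs_Succ)
next
  case (succ_neqI \<Gamma> a b)
  then show ?case by (simp add: holds_Succ_neq)
next
  case (succ_neqE \<Gamma> a b)
  then show ?case by (simp add: holds_Succ_neq)
next
  case (succ_eqE \<Gamma> a b)
  then show ?case by (auto simp: holds_Eq runs_Succ)
next
  case (bot_isNE p \<Gamma>)
  then show ?case by (auto simp: holds_Eq)
next
  case (nat_induction c \<Gamma> i a)
  then show ?case using valid_induction[of \<Gamma> i c a] by (simp del: valid.simps)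
next
  case (conv_expand c c' \<Gamma>)
  then show ?case by (auto simp: holds_def head_step_runs)
next
  case (conv_reduce c c' \<Gamma>)
  then show ?case by (auto simp: holds_def head_step_runs)
next
  case (conv_eq c c' \<Gamma>)
  then show ?case by (auto simp: holds_Eq head_step_runs)
next
  case (rec_succ g \<Gamma> m h)
  then show ?case using valid_rec_succ[of \<Gamma> m h g] by (simp del: valid.simps)
next
  case (allI \<Gamma> f)
  then show ?case using valid_allI by (simp del: valid.simps)
next
  case (allE \<Gamma> f a)
  have "holds \<sigma> (f \<cdot> a)" if all: "holds \<sigma> (AllC \<cdot> f)" and nat: "holds \<sigma> (isN a)" for \<sigma>
  proof -
    from nat obtain n where "runs (psub \<sigma> a) [] n" by (auto simp: holds_Eq)
    moreover from all have "runs (psub \<sigma> f \<cdot> num n) [] 1" unfolding holds_All ..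
    moreover have "runs (num n) [] n" by simp
    ultimately have "runs (psub \<sigma> f \<cdot> psub \<sigma> a) [] 1" by (blast intro: same_value_App)
    then show ?thesis by (simp add: holds_def)
  qed
  with allE show ?case by auto
next
  case (neg_allI \<Gamma> f a)
  have "holds \<sigma> (\<^bold>\<not> (AllC \<cdot> f))" if neg: "holds \<sigma> (\<^bold>\<not> (f \<cdot> a))" and nat: "holds \<sigma> (isN a)" for \<sigma>
  proof -
    from nat obtain n where "runs (psub \<sigma> a) [] n" by (auto simp: holds_Eq)
    moreover from neg have "runs (psub \<sigma> f \<cdot> psub \<sigma> a) [] 0" by (simp add: holds_Neg)
    moreover have "runs (num n) [] n" by simp
    ultimately have "runs (psub \<sigma> f \<cdot> num n) [] 0" by (blast intro: same_value_App)
    then show ?thesis unfolding holds_neg_All ..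
  qed
  with neg_allI show ?case by auto
next
  case (neg_allE \<Gamma> f c)
  then show ?case using valid_neg_allE[of \<Gamma> f c] by (simp del: valid.simps)
qed

theorem derivable_valid:
  assumes "derivable j"
  shows "valid j"
proof -
  from assms obtain js where js: "is_proof js" "j \<in> set js" by (auto simp: derivable_def)
  have "valid (js ! n)" if "n < length js" for n
    using that
  proof (induction n rule: less_induct)
    case (less n)
    with js(1) obtain P where P: "P \<subseteq> set (take n js)" "rga_rule P (js ! n)"
      by (auto simp: is_proof_def)
    have "valid i" if "i \<in> P" for i
      using that P(1) less by (force simp: in_set_conv_nth)
    with P(2) show ?case by (blast intro: rga_rule_valid)
  qed
  with js(2) show ?thesis by (auto simp: in_set_conv_nth)
qed

section \<open>The Liar has no value\<close>

text \<open>
  The term \<open>D \<cdot> D\<close>, to which the Liar reduces, has exactly the values of its own negation. A value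
  would have to be 0 or 1, and evaluating the negation swaps the two.
\<close>

lemma Liar_no_value: "\<not> runs Liar [] n"
proof
  define D where "D = Lam (Lam (\<^bold>\<not> Var 0) \<cdot> (Var 0 \<cdot> Var 0))"
  have DD: "runs (D \<cdot> D) [] m \<longleftrightarrow> runs (\<^bold>\<not> (D \<cdot> D)) [] m" for m
    unfolding D_def by (simp add: runs_Lam)
  assume "runs Liar [] n"
  then have n: "runs (D \<cdot> D) [] n"
    unfolding Liar_def Y_comb_def D_def by (simp add: runs_Lam)
  with DD have "runs (\<^bold>\<not> (D \<cdot> D)) [] n" by blast
  then consider "n = 0" "runs (D \<cdot> D) [] 1" | "n = 1" "runs (D \<cdot> D) [] 0"
    unfolding runs_Neg by blast
  then show False
    by cases (metis n value_unique zero_neq_one)+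
qed

theorem theorem7p3:
  shows "derivable ({|Liar|} \<turnstile> Liar) \<and> \<not> derivable ({||} \<turnstile> \<^bold>\<not> Liar \<^bold>\<or> Liar)"
proof
  have "wf_tm Liar" by (simp add: Liar_def Y_comb_def signature_def)
  then have "is_proof [{|Liar|} \<turnstile> Liar]"
    using hyp[of Liar "{||}"] by (auto simp: is_proof_def)
  then show "derivable ({|Liar|} \<turnstile> Liar)" by (force simp: derivable_def)
next
  show "\<not> derivable ({||} \<turnstile> \<^bold>\<not> Liar \<^bold>\<or> Liar)"
  proof
    assume "derivable ({||} \<turnstile> \<^bold>\<not> Liar \<^bold>\<or> Liar)"
    then have "holds Var (\<^bold>\<not> Liar \<^bold>\<or> Liar)" using derivable_valid by fastforce
    moreover have "\<not> holds Var Liar" by (simp add: holds_def psub_Var Liar_no_value)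
    ultimately show False by (simp add: holds_Disj holds_Neg psub_Var Liar_no_value)
  qed
qed

end
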